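(* Let $T$ be a bounded linear operator on a complex Banach space with $\sigma(T)=\{1\}$. Suppose that for some positive integers $m>n$ we have $$\|T^m-T^n\|<\left(1-\frac nm\right)\left(\frac nm\right)^{n/(m-n)}.$$ Then $\|T-I\|<1-\left(\frac nm\right)^{1/(m-n)}$.
   Context: All Banach spaces are complex. $\sigma(T)$ denotes the spectrum of $T$, $I$ is the identity operator, and $\|\cdot\|$ is the operator norm. *)

theory Defs
  imports "HOL-Analysis.Analysis"
begin

text \<open>The library has real Banach spaces only.  A complex Banach space is a real one whose scalar
  multiplication extends to the complex numbers, with the same norm.\<close>

class complex_banach = banach +
  fixes scaleC :: "complex \<Rightarrow> 'a \<Rightarrow> 'a"  (infixr \<open>*\<^sub>C\<close> 75)
  assumes scaleC_add_right: "c *\<^sub>C (x + y) = c *\<^sub>C x + c *\<^sub>C y"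
    and scaleC_add_left: "(c + d) *\<^sub>C x = c *\<^sub>C x + d *\<^sub>C x"
    and scaleC_scaleC: "c *\<^sub>C d *\<^sub>C x = (c * d) *\<^sub>C x"
    and scaleC_of_real: "complex_of_real r *\<^sub>C x = r *\<^sub>R x"
    and norm_scaleC: "norm (c *\<^sub>C x) = cmod c * norm x"

instantiation complex :: complex_banach
begin

definition scaleC_complex :: "complex \<Rightarrow> complex \<Rightarrow> complex"
  where "scaleC_complex c x = c * x"

instance
  by standard (simp_all add: scaleC_complex_def algebra_simps norm_mult scaleR_conv_of_real)

end

definition bounded_clinear :: "('a::complex_banach \<Rightarrow> 'b::complex_banach) \<Rightarrow> bool"
  where "bounded_clinear T \<longleftrightarrow> bounded_linear T \<and> (\<forall>c x. T (c *\<^sub>C x) = c *\<^sub>C T x)"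

definition spectrum :: "('a::complex_banach \<Rightarrow> 'a) \<Rightarrow> complex set"
  where "spectrum T = {z. \<not> (\<exists>S. bounded_clinear S \<and>
    S \<circ> (\<lambda>x. T x - z *\<^sub>C x) = id \<and> (\<lambda>x. T x - z *\<^sub>C x) \<circ> S = id)}"

end

theory Submission
  imports Defs
begin

text \<open>
  Put \<open>S = I - T\<close> and \<open>g x = (1 - x)\<^sup>n - (1 - x)\<^sup>m\<close>, so that \<open>T\<^sup>n - T\<^sup>m = g S\<close> and \<open>S\<close> has spectrum
  \<open>{0}\<close>.  On \<open>[0, w]\<close>, where \<open>w = 1 - (n/m)\<^bsup>1/(m-n)\<^esup>\<close>, the function \<open>g\<close> increases from \<open>0\<close> to its
  maximum \<open>g w\<close>, and \<open>g w\<close> is the bound in the hypothesis (\<open>trinomial_critical_value\<close>).  Let \<open>h\<close>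
  (\<open>inv_series\<close>) be the power series inverse to \<open>g\<close> at \<open>0\<close>; the comments below keep the letters
  \<open>g\<close>, \<open>h\<close> and \<open>w\<close>.  If \<open>h\<close> has nonnegative coefficients and \<open>S = h (g S)\<close>, then
  \<open>\<parallel>S\<parallel> \<le> h \<parallel>g S\<parallel> < w\<close> (\<open>quasinilpotent_norm_less\<close>).

  Nonnegativity (\<open>inv_series_nonneg\<close>) comes from the differential equation \<open>h' \<cdot> g'(h) = 1\<close>: expressed
  through \<open>y = 1/(1 - h)\<close> it determines the coefficients recursively, with no subtraction.  Because of
  the nonnegativity, truncation turns the equation into an inequality for the partial sums, from which
  \<open>g (H u) \<le> u\<close> for each partial sum \<open>H\<close> (\<open>trinomial_psum_le\<close>).  Hence the partial sums at a point
  below \<open>g w\<close> stay below \<open>w\<close>, which also shows that \<open>h\<close> converges there.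

  For \<open>S = h (g S)\<close> (\<open>inv_series_sums\<close>) it is used that \<open>S\<close> is quasinilpotent: its powers decay faster
  than any geometric sequence, so formal identities between power series with a positive radius of
  convergence hold at \<open>S\<close>, whatever its norm.  The step from the spectrum to the powers is the spectral
  radius formula (\<open>quasinilpotent_of_resolvent\<close>), obtained here by averaging the resolvent over roots
  of unity instead of integrating it.
\<close>

unbundle no vec_syntax and fps_syntax

section \<open>Partial sums of power series with nonnegative coefficients\<close>

definition psum :: "real fps \<Rightarrow> nat \<Rightarrow> real \<Rightarrow> real"
  where "psum f N u = (\<Sum>k<N. f $ k * u ^ k)"

lemma psum_add: "psum (f + g) N u = psum f N u + psum g N u"
  by (simp add: psum_def sum.distrib algebra_simps)

lemma psum_diff: "psum (f - g) N u = psum f N u - psum g N u"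
  by (simp add: psum_def sum_subtractf algebra_simps)

lemma psum_const_mult: "psum (fps_const c * f) N u = c * psum f N u"
  by (simp add: psum_def sum_distrib_left mult.assoc)

lemma psum_one: "psum 1 N u = (if N = 0 then 0 else 1)"
proof -
  have "psum 1 N u = (\<Sum>k<N. if k = 0 then 1 else 0)"
    unfolding psum_def by (rule sum.cong) auto
  then show ?thesis by simp
qed

lemma psum_nonneg:
  assumes "\<And>k. f $ k \<ge> 0" "u \<ge> 0"
  shows "psum f N u \<ge> 0"
  unfolding psum_def using assms by (intro sum_nonneg mult_nonneg_nonneg) auto

lemma psum_le_Suc:
  assumes "\<And>k. f $ k \<ge> 0" "u \<ge> 0"
  shows "psum f N u \<le> psum f (Suc N) u"
  unfolding psum_def using assms by simp

lemma psum_mono: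
  assumes "\<And>k. f $ k \<ge> 0" "0 \<le> u" "u \<le> v"
  shows "psum f N u \<le> psum f N v"
  unfolding psum_def using assms by (intro sum_mono mult_left_mono power_mono) auto

text \<open>With nonnegative coefficients, truncating both factors before multiplying only adds terms, namely
  those of order at least \<open>N\<close>.  This lets an identity between power series be read as an inequality
  between partial sums, with no convergence assumed.\<close>

lemma psum_mult_le:
  assumes f: "\<And>k. f $ k \<ge> 0" and g: "\<And>k. g $ k \<ge> 0" and u: "u \<ge> 0"
  shows "psum (f * g) N u \<le> psum f N u * psum g N u"
proof -
  let ?t = "\<lambda>i j. (f $ i * u ^ i) * (g $ j * u ^ j)"
  have "psum (f * g) N u = (\<Sum>k<N. \<Sum>i\<le>k. ?t i (k - i))"
    unfolding psum_def fps_mult_nth sum_distrib_right atLeast0AtMost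
  proof (intro sum.cong refl)
    fix k i :: nat assume "i \<in> {..k}"
    then have "u ^ k = u ^ i * u ^ (k - i)" by (simp flip: power_add)
    then show "f $ i * g $ (k - i) * u ^ k = ?t i (k - i)" by simp
  qed
  also have "\<dots> = (\<Sum>(i, j)\<in>{(i, j). i + j < N}. ?t i j)"
    by (rule sum.triangle_reindex[symmetric])
  also have "\<dots> \<le> (\<Sum>(i, j)\<in>{..<N} \<times> {..<N}. ?t i j)"
    using f g u by (intro sum_mono2) auto
  also have "\<dots> = psum f N u * psum g N u"
    by (simp add: psum_def sum_product sum.cartesian_product)
  finally show ?thesis .
qed

lemma fps_mult_nth_nonneg:
  fixes f g :: "real fps"
  assumes "\<And>j. j \<le> k \<Longrightarrow> f $ j \<ge> 0" "\<And>j. j \<le> k \<Longrightarrow> g $ j \<ge> 0"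
  shows "(f * g) $ k \<ge> 0"
  unfolding fps_mult_nth using assms by (intro sum_nonneg mult_nonneg_nonneg) auto

lemma fps_power_nth_nonneg:
  fixes f :: "real fps"
  assumes "\<And>j. j \<le> k \<Longrightarrow> f $ j \<ge> 0"
  shows "(f ^ i) $ k \<ge> 0"
  using assms
proof (induction i arbitrary: k)
  case (Suc i)
  then show ?case by (simp only: power_Suc) (intro fps_mult_nth_nonneg, auto)
qed simp

lemma psum_power_le:
  assumes f: "\<And>k. f $ k \<ge> 0" and u: "u \<ge> 0"
  shows "psum (f ^ i) N u \<le> psum f N u ^ i"
proof (induction i)
  case 0
  show ?case by (simp add: psum_one)
next
  case (Suc i)
  have "psum (f ^ Suc i) N u \<le> psum f N u * psum (f ^ i) N u"
    unfolding power_Suc using f u by (intro psum_mult_le fps_power_nth_nonneg)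
  also have "\<dots> \<le> psum f N u * psum f N u ^ i"
    using Suc psum_nonneg[OF f u] by (intro mult_left_mono)
  finally show ?case by simp
qed

lemma psum_has_derivative:
  "((psum f (Suc N)) has_real_derivative psum (fps_deriv f) N u) (at u)"
proof -
  have e: "psum f (Suc N) = (\<lambda>u. f $ 0 + (\<Sum>k<N. f $ Suc k * u ^ Suc k))"
    by (rule ext) (simp only: psum_def sum.lessThan_Suc_shift power_0 mult_1_right)
  show ?thesis unfolding e psum_def
    by (rule derivative_eq_intros refl)+ (auto intro!: sum.cong simp: algebra_simps)
qed

text \<open>The geometric series \<open>1 + h + h\<^sup>2 + \<dots>\<close>, in the form \<open>y = 1 + h y\<close>.  The hypothesis
  stops at order \<open>k\<close> because \<open>inv_series_nonneg\<close> uses this lemma inside an induction, where the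
  later coefficients are not yet known to be nonnegative.\<close>

lemma fps_inverse_one_minus_nth_nonneg:
  fixes h :: "real fps"
  assumes h0: "h $ 0 = 0" and h: "\<And>j. j \<le> k \<Longrightarrow> h $ j \<ge> 0"
  shows "inverse (1 - h) $ k \<ge> 0"
  using h
proof (induction k rule: less_induct)
  case (less k)
  let ?y = "inverse (1 - h)"
  have "?y * (1 - h) = 1" using h0 by (intro inverse_mult_eq_1) simp
  then have y: "?y = 1 + h * ?y" by (simp add: algebra_simps)
  have "(h * ?y) $ k \<ge> 0"
    unfolding fps_mult_nth
  proof (intro sum_nonneg)
    fix i assume i: "i \<in> {0..k}"
    show "h $ i * ?y $ (k - i) \<ge> 0"
    proof (cases "i = 0")
      case True
      then show ?thesis by (simp add: h0)
    next
      case False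
      with i have "k - i < k" by auto
      then have "?y $ (k - i) \<ge> 0" using less by simp
      with less.prems i show ?thesis by auto
    qed
  qed
  moreover have "?y $ k = (if k = 0 then 1 else 0) + (h * ?y) $ k"
    by (subst y) simp
  ultimately show ?case by simp
qed

section \<open>The inverse of the trinomial\<close>

definition trinomial_fps :: "nat \<Rightarrow> nat \<Rightarrow> real fps"
  where "trinomial_fps m n = (1 - fps_X) ^ n - (1 - fps_X) ^ m"

definition inv_series :: "nat \<Rightarrow> nat \<Rightarrow> real fps"
  where "inv_series m n = fps_inv (trinomial_fps m n)"

lemma trinomial_fps_nth_0: "trinomial_fps m n $ 0 = 0"
  by (simp add: trinomial_fps_def fps_power_zeroth)

lemma one_minus_X_power_nth_1: "((1 - fps_X :: real fps) ^ n) $ 1 = - real n"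
  by (induction n) (auto simp: fps_mult_nth fps_power_zeroth)

lemma trinomial_fps_nth_1: "trinomial_fps m n $ 1 = real m - real n"
  by (simp only: trinomial_fps_def fps_sub_nth one_minus_X_power_nth_1)

lemma inv_series_nth_0: "inv_series m n $ 0 = 0"
  by (simp add: inv_series_def fps_inv_def)

context
  fixes m n :: nat
  assumes nm: "0 < n" "n < m"
begin

lemma inv_series_compose_trinomial: "inv_series m n oo trinomial_fps m n = fps_X"
  unfolding inv_series_def using nm trinomial_fps_nth_1[of m n]
  by (intro fps_inv) (auto simp: trinomial_fps_nth_0)

lemma trinomial_compose_inv_series:
  "(1 - inv_series m n) ^ n - (1 - inv_series m n) ^ m = fps_X"
proof -
  have "trinomial_fps m n oo inv_series m n = fps_X"
    unfolding inv_series_def using nm trinomial_fps_nth_1[of m n]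
    by (intro fps_inv_right) (auto simp: trinomial_fps_nth_0)
  then show ?thesis
    by (simp add: trinomial_fps_def fps_compose_sub_distrib inv_series_nth_0
        flip: fps_compose_power[OF inv_series_nth_0])
qed

text \<open>Differentiating \<open>(1 - h)\<^sup>n - (1 - h)\<^sup>m = X\<close> gives \<open>h' (m (1 - h)\<^bsup>m-1\<^esup> - n (1 - h)\<^bsup>n-1\<^esup>) = 1\<close>.
  Multiplying by \<open>y\<^bsup>m-1\<^esup>\<close>, where \<open>y = 1/(1 - h)\<close>, and moving the negative term to the right leaves an
  equation all of whose ingredients have nonnegative coefficients as soon as \<open>h\<close> has.\<close>

lemma inv_series_deriv_eq:
  defines "y \<equiv> inverse (1 - inv_series m n)"
  shows "fps_const (real (m - n)) * fps_deriv (inv_series m n)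
    = y ^ (m - 1) + fps_const (real n) * ((y ^ (m - n) - 1) * fps_deriv (inv_series m n))"
proof -
  let ?h = "inv_series m n" and ?c = "\<lambda>k. fps_const (real k)"
  have y: "y * (1 - ?h) = 1" unfolding y_def
    by (intro inverse_mult_eq_1) (simp add: inv_series_nth_0)
  have yp: "y ^ k * (1 - ?h) ^ k = 1" for k
    by (simp add: y flip: power_mult_distrib)
  have "fps_deriv ((1 - ?h) ^ n - (1 - ?h) ^ m) = 1"
    by (simp add: trinomial_compose_inv_series)
  then have D: "?c m * (1 - ?h) ^ (m - 1) * fps_deriv ?h - ?c n * (1 - ?h) ^ (n - 1) * fps_deriv ?h = 1"
    by (simp add: fps_deriv_power algebra_simps)
  have split: "m - 1 = (m - n) + (n - 1)" using nm by simp
  have "y ^ (m - 1) = y ^ (m - 1) * (?c m * (1 - ?h) ^ (m - 1) * fps_deriv ?h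
      - ?c n * (1 - ?h) ^ (n - 1) * fps_deriv ?h)"
    by (simp only: D) simp
  also have "\<dots> = ?c m * (y ^ (m - 1) * (1 - ?h) ^ (m - 1)) * fps_deriv ?h
      - ?c n * y ^ (m - n) * (y ^ (n - 1) * (1 - ?h) ^ (n - 1)) * fps_deriv ?h"
    unfolding split power_add by (simp add: algebra_simps)
  also have "\<dots> = ?c m * fps_deriv ?h - ?c n * y ^ (m - n) * fps_deriv ?h"
    by (simp only: yp) simp
  finally have e: "y ^ (m - 1) = ?c m * fps_deriv ?h - ?c n * y ^ (m - n) * fps_deriv ?h" .
  have c: "?c (m - n) = ?c m - ?c n" using nm by (simp add: of_nat_diff)
  show ?thesis unfolding e c by (simp add: algebra_simps del: fps_const_sub fps_const_add)
qed

text \<open>Compare coefficients of order \<open>l\<close> in \<open>inv_series_deriv_eq\<close>.  Since \<open>y\<^bsup>m-n\<^esup> - 1\<close> has no constant term,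
  the right-hand side involves only the coefficients of \<open>h\<close> up to order \<open>l\<close>, while the left-hand side
  is a positive multiple of the one of order \<open>l + 1\<close>.\<close>

lemma inv_series_nonneg: "inv_series m n $ k \<ge> 0"
proof (induction k rule: less_induct)
  case (less k)
  let ?h = "inv_series m n"
  define y where "y = inverse (1 - ?h)"
  show ?case
  proof (cases k)
    case 0
    then show ?thesis by (simp add: inv_series_nth_0)
  next
    case (Suc l)
    have h: "?h $ j \<ge> 0" if "j \<le> l" for j using less that Suc by simp
    have y: "y $ j \<ge> 0" if "j \<le> l" for j
      unfolding y_def using that h by (intro fps_inverse_one_minus_nth_nonneg inv_series_nth_0) auto
    have yd: "(y ^ (m - n) - 1) $ j \<ge> 0" if "j \<le> l" for j
    proof (cases "j = 0")
      case True
      then show ?thesis by (simp add: y_def inv_series_nth_0 fps_power_zeroth)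
    next
      case False
      then show ?thesis using fps_power_nth_nonneg[of j y] y that by simp
    qed
    have "((y ^ (m - n) - 1) * fps_deriv ?h) $ l \<ge> 0"
      unfolding fps_mult_nth
    proof (intro sum_nonneg)
      fix i assume i: "i \<in> {0..l}"
      show "(y ^ (m - n) - 1) $ i * fps_deriv ?h $ (l - i) \<ge> 0"
      proof (cases "i = 0")
        case True
        then show ?thesis by (simp add: y_def inv_series_nth_0 fps_power_zeroth)
      next
        case False
        with i have "?h $ (l - i + 1) \<ge> 0" by (intro h) auto
        with yd[of i] i show ?thesis by auto
      qed
    qed
    moreover have "(y ^ (m - 1)) $ l \<ge> 0" using y by (intro fps_power_nth_nonneg)
    moreover have "(fps_const (real (m - n)) * fps_deriv ?h) $ l
        = (y ^ (m - 1) + fps_const (real n) * ((y ^ (m - n) - 1) * fps_deriv ?h)) $ l"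
      by (simp only: inv_series_deriv_eq y_def)
    ultimately have "real (m - n) * (real (l + 1) * ?h $ k) \<ge> 0"
      by (simp add: Suc)
    then show ?thesis using nm by (simp add: zero_le_mult_iff)
  qed
qed

lemma inv_series_inverse_nonneg: "inverse (1 - inv_series m n) $ k \<ge> 0"
  by (intro fps_inverse_one_minus_nth_nonneg inv_series_nth_0 inv_series_nonneg)

text \<open>The differential equation of \<open>inv_series_deriv_eq\<close> becomes an inequality for partial sums.  In terms
  of \<open>g x = (1 - x)\<^sup>n - (1 - x)\<^sup>m\<close> the conclusion says that the derivative of \<open>g \<circ> H\<close> is at most \<open>1\<close>.\<close>

lemma psum_inv_series_ode:
  assumes u: "u \<ge> 0" and H1: "psum (inv_series m n) (Suc N) u < 1" and N: "N > 0"
  defines "H \<equiv> psum (inv_series m n) (Suc N) u"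
    and "D \<equiv> psum (fps_deriv (inv_series m n)) N u"
  shows "D * (real m * (1 - H) ^ (m - 1) - real n * (1 - H) ^ (n - 1)) \<le> 1"
proof -
  let ?h = "inv_series m n" and ?d = "m - n"
  define y where "y = inverse (1 - ?h)"
  define Y where "Y = psum y N u"
  define z where "z = 1 / (1 - H)"
  have H1: "H < 1" using H1 by (simp add: H_def)
  have ynn: "y $ k \<ge> 0" for k unfolding y_def by (rule inv_series_inverse_nonneg)
  have Y0: "Y \<ge> 0" unfolding Y_def by (rule psum_nonneg[OF ynn u])
  have dnn: "fps_deriv ?h $ k \<ge> 0" for k by (simp add: inv_series_nonneg)
  have D0: "D \<ge> 0" unfolding D_def by (rule psum_nonneg[OF dnn u])
  have "y * (1 - ?h) = 1" unfolding y_def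
    by (intro inverse_mult_eq_1) (simp add: inv_series_nth_0)
  then have y: "y = 1 + ?h * y" by (simp add: algebra_simps)
  have "Y = 1 + psum (?h * y) N u" unfolding Y_def by (subst y) (use N in \<open>simp add: psum_add psum_one\<close>)
  also have "\<dots> \<le> 1 + psum ?h N u * Y" unfolding Y_def
    by (intro add_left_mono psum_mult_le inv_series_nonneg ynn u)
  also have "\<dots> \<le> 1 + H * Y" unfolding H_def
    by (intro add_left_mono mult_right_mono psum_le_Suc inv_series_nonneg u Y0)
  finally have Yz: "Y \<le> z" using H1 by (simp add: z_def field_simps)
  have z0: "z > 0" using H1 by (simp add: z_def)
  have ydnn: "(y ^ ?d - 1) $ k \<ge> 0" for k
    using fps_power_nth_nonneg[of k y] ynn
    by (cases "k = 0") (auto simp: y_def inv_series_nth_0 fps_power_zeroth)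
  have "real ?d * D = psum (fps_const (real ?d) * fps_deriv ?h) N u"
    by (simp add: D_def psum_const_mult)
  also have "\<dots> = psum (y ^ (m - 1)) N u + real n * psum ((y ^ ?d - 1) * fps_deriv ?h) N u"
    by (simp only: inv_series_deriv_eq y_def psum_add psum_const_mult)
  also have "\<dots> \<le> Y ^ (m - 1) + real n * (psum (y ^ ?d - 1) N u * D)"
    unfolding Y_def D_def
    by (intro add_mono mult_left_mono psum_power_le psum_mult_le ynn ydnn dnn u) auto
  also have "psum (y ^ ?d - 1) N u \<le> Y ^ ?d - 1"
    using psum_power_le[OF ynn u, of ?d N] N by (simp add: psum_diff psum_one Y_def)
  also have "Y ^ (m - 1) \<le> z ^ (m - 1)" using Yz Y0 by (rule power_mono)
  also have "Y ^ ?d \<le> z ^ ?d" using Yz Y0 by (rule power_mono)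
  finally have "real ?d * D \<le> z ^ (m - 1) + real n * ((z ^ ?d - 1) * D)"
    using D0 by (simp add: mult_right_mono mult_left_mono)
  then have *: "D * (real m - real n * z ^ ?d) \<le> z ^ (m - 1)"
    using nm by (simp add: of_nat_diff algebra_simps)
  have zH: "z ^ k * (1 - H) ^ k = 1" for k
    using H1 by (simp add: z_def power_divide)
  have split: "m - 1 = ?d + (n - 1)" using nm by simp
  have "D * (real m * (1 - H) ^ (m - 1) - real n * (1 - H) ^ (n - 1))
      = D * (real m * (1 - H) ^ (m - 1) - real n * (z ^ ?d * (1 - H) ^ ?d) * (1 - H) ^ (n - 1))"
    by (simp add: zH)
  also have "\<dots> = D * (real m - real n * z ^ ?d) * (1 - H) ^ (m - 1)"
    unfolding split power_add by (simp add: algebra_simps)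
  also have "\<dots> \<le> z ^ (m - 1) * (1 - H) ^ (m - 1)"
    using * H1 by (intro mult_right_mono) auto
  finally show ?thesis by (simp add: zH)
qed

lemma trinomial_psum_le:
  assumes u: "u \<ge> 0" and H1: "psum (inv_series m n) (Suc N) u < 1" and N: "N > 0"
  shows "(1 - psum (inv_series m n) (Suc N) u) ^ n - (1 - psum (inv_series m n) (Suc N) u) ^ m \<le> u"
proof -
  let ?H = "psum (inv_series m n) (Suc N)"
  let ?f = "\<lambda>t. (1 - ?H t) ^ n - (1 - ?H t) ^ m - t"
  have "?f u \<le> ?f 0"
  proof (rule DERIV_nonpos_imp_nonincreasing[OF u])
    fix t assume t: "0 \<le> t" "t \<le> u"
    have "?H t < 1" using psum_mono[OF inv_series_nonneg t] H1 by (rule order.strict_trans1)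
    note ode = psum_inv_series_ode[OF t(1) this N]
    have "(?f has_real_derivative psum (fps_deriv (inv_series m n)) N t *
       (real m * (1 - ?H t) ^ (m - 1) - real n * (1 - ?H t) ^ (n - 1)) - 1) (at t)"
      by (rule derivative_eq_intros psum_has_derivative refl)+ (simp add: algebra_simps)
    with ode show "\<exists>y. DERIV ?f t :> y \<and> y \<le> 0" by (intro exI conjI) auto
  qed
  moreover have "?H 0 = 0" unfolding psum_def
    by (subst sum.lessThan_Suc_shift) (simp add: inv_series_nth_0)
  ultimately show ?thesis by simp
qed

text \<open>By \<open>trinomial_psum_le\<close>, a partial sum \<open>H\<close> that reached \<open>w\<close> at some \<open>t \<le> r\<close> would give
  \<open>g w \<le> t \<le> r < g w\<close>, so every partial sum at \<open>r\<close> stays below \<open>w\<close>.  They stay away from \<open>w\<close>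
  uniformly, since \<open>g\<close> is at most \<open>r\<close> at these values but exceeds \<open>r\<close> near \<open>w\<close>.\<close>

lemma psum_inv_series_bounded:
  assumes w: "0 < w" "w < 1" and r: "0 \<le> r" "r < (1 - w) ^ n - (1 - w) ^ m"
  shows "\<exists>L<w. \<forall>N. psum (inv_series m n) N r \<le> L"
proof -
  let ?g = "\<lambda>x::real. (1 - x) ^ n - (1 - x) ^ m"
  let ?H = "\<lambda>N. psum (inv_series m n) (Suc N)"
  have H0: "?H N 0 = 0" for N unfolding psum_def
    by (subst sum.lessThan_Suc_shift) (simp add: inv_series_nth_0)
  have less: "?H N r < w" if N: "N > 0" for N
  proof (rule ccontr)
    assume "\<not> ?H N r < w"
    then have "\<exists>t. 0 \<le> t \<and> t \<le> r \<and> ?H N t = w"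
      using w r H0 by (intro IVT') (auto intro!: continuous_intros simp: psum_def)
    then obtain t where t: "0 \<le> t" "t \<le> r" "?H N t = w" by blast
    then have "?g w \<le> t" using trinomial_psum_le[of t N] w N by simp
    with t r show False by simp
  qed
  have gH: "?g (?H N r) \<le> r" if "N > 0" for N
    using trinomial_psum_le[OF r(1) _ that] less[OF that] w by simp
  have "isCont ?g w" by (intro continuous_intros)
  then have "\<forall>\<^sub>F x in at w. ?g x > r"
    using r by (intro order_tendstoD) (auto simp: isCont_def)
  then obtain e where e: "e > 0" "\<And>x. x \<noteq> w \<Longrightarrow> dist x w < e \<Longrightarrow> ?g x > r"
    unfolding eventually_at by blast
  have HL: "?H N r \<le> w - e" if "N > 0" for N
    using e(2)[of "?H N r"] less[OF that] gH[OF that] e(1) by (force simp: dist_real_def)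
  have "psum (inv_series m n) N r \<le> w - e" for N
  proof -
    have "psum (inv_series m n) N r \<le> ?H N r"
      by (intro psum_le_Suc inv_series_nonneg r)
    also have "\<dots> \<le> ?H (Suc N) r" by (intro psum_le_Suc inv_series_nonneg r)
    also have "\<dots> \<le> w - e" by (rule HL) simp
    finally show ?thesis .
  qed
  then show ?thesis using e(1) by (intro exI[of _ "w - e"]) auto
qed

end

text \<open>The bound of the theorem is the maximum of \<open>x \<mapsto> (1 - x)\<^sup>n - (1 - x)\<^sup>m\<close> on the unit interval: the
  derivative vanishes where \<open>(1 - x)\<^bsup>m-n\<^esup> = n/m\<close>, which is the point \<open>w\<close>.\<close>

lemma trinomial_critical_value:
  fixes m n :: nat
  assumes "0 < n" "n < m"
  defines "q \<equiv> real n / real m"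
  defines "w \<equiv> 1 - q powr (1 / (real m - real n))"
  shows "0 < w" "w < 1"
    and "(1 - w) ^ n - (1 - w) ^ m = (1 - q) * q powr (real n / (real m - real n))"
proof -
  have q: "0 < q" "q < 1" using assms by (auto simp: q_def)
  show "0 < w" "w < 1" using q assms powr_less_mono2[of "1 / (real m - real n)" q 1]
    by (auto simp: w_def)
  have p: "(1 - w) ^ k = q powr (real k / (real m - real n))" for k
    using q by (simp add: w_def powr_powr flip: powr_realpow)
  have "real m / (real m - real n) = 1 + real n / (real m - real n)"
    using assms by (simp add: field_simps)
  then have "q powr (real m / (real m - real n)) = q * q powr (real n / (real m - real n))"
    using q by (simp add: powr_add)
  then show "(1 - w) ^ n - (1 - w) ^ m = (1 - q) * q powr (real n / (real m - real n))"
    by (simp add: p algebra_simps)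
qed

section \<open>Polynomials in an element of a normed algebra\<close>

text \<open>Evaluation at an element of an algebra without commutativity.  The sort asks for a unit but not for
  \<open>norm 1 = 1\<close>, so that it also covers the operators on the zero space.\<close>

definition peval :: "real poly \<Rightarrow> 'b::{real_normed_algebra,monoid_mult} \<Rightarrow> 'b"
  where "peval p x = (\<Sum>j\<le>degree p. coeff p j *\<^sub>R x ^ j)"

lemma peval_pCons: "peval (pCons a p) x = a *\<^sub>R 1 + x * peval p x"
proof (cases "p = 0")
  case True
  then show ?thesis by (simp add: peval_def)
next
  case False
  then show ?thesis
    by (simp add: peval_def sum.atMost_Suc_shift sum_distrib_left del: sum.atMost_Suc)
qed

lemma peval_0 [simp]: "peval 0 x = 0"
  by (simp add: peval_def)

lemma peval_1 [simp]: "peval 1 x = 1"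
  by (simp add: one_pCons peval_pCons)

lemma peval_add: "peval (p + q) x = peval p x + peval q x"
  by (induction p q rule: poly_induct2) (simp_all add: peval_pCons algebra_simps)

lemma peval_smult: "peval (smult c p) x = c *\<^sub>R peval p x"
  by (induction p) (simp_all add: peval_pCons algebra_simps)

lemma peval_diff: "peval (p - q) x = peval p x - peval q x"
  using peval_add[of "p - q" q x] by (simp add: algebra_simps)

lemma peval_mult: "peval (p * q) x = peval p x * peval q x"
  by (induction p) (simp_all add: peval_pCons peval_add peval_smult algebra_simps mult_pCons_left)

lemma peval_power: "peval (p ^ k) x = peval p x ^ k"
  by (induction k) (simp_all add: peval_mult)

lemma peval_sum: "peval (\<Sum>k\<in>A. f k) x = (\<Sum>k\<in>A. peval (f k) x)"
  by (induction A rule: infinite_finite_induct) (simp_all add: peval_add)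

text \<open>The weighted \<open>\<ell>\<^sup>1\<close> norm of the coefficients.  It is submultiplicative, and up to a constant it
  dominates evaluation at an element whose powers grow no faster than those of the weight
  (\<open>norm_peval_le\<close>).\<close>

definition wnorm :: "real poly \<Rightarrow> real \<Rightarrow> real"
  where "wnorm p s = (\<Sum>j\<le>degree p. \<bar>coeff p j\<bar> * s ^ j)"

lemma wnorm_pCons: "wnorm (pCons a p) s = \<bar>a\<bar> + s * wnorm p s"
proof (cases "p = 0")
  case True
  then show ?thesis by (simp add: wnorm_def)
next
  case False
  then show ?thesis
    by (simp add: wnorm_def sum.atMost_Suc_shift sum_distrib_left mult_ac del: sum.atMost_Suc)
qed

lemma wnorm_0 [simp]: "wnorm 0 s = 0"
  by (simp add: wnorm_def)

lemma wnorm_1 [simp]: "wnorm 1 s = 1"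
  by (simp add: one_pCons wnorm_pCons)

lemma wnorm_nonneg: "s \<ge> 0 \<Longrightarrow> wnorm p s \<ge> 0"
  by (simp add: wnorm_def sum_nonneg)

lemma wnorm_add_le:
  assumes "s \<ge> 0"
  shows "wnorm (p + q) s \<le> wnorm p s + wnorm q s"
proof (induction p q rule: poly_induct2)
  case (pCons a p b q)
  have "s * wnorm (p + q) s \<le> s * wnorm p s + s * wnorm q s"
    using mult_left_mono[OF pCons assms] by (simp add: algebra_simps)
  then show ?case using abs_triangle_ineq[of a b] by (simp add: wnorm_pCons)
qed simp

lemma wnorm_smult: "wnorm (smult c p) s = \<bar>c\<bar> * wnorm p s"
  by (induction p) (simp_all add: wnorm_pCons abs_mult algebra_simps)

lemma wnorm_mult_le:
  assumes s: "s \<ge> 0"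
  shows "wnorm (p * q) s \<le> wnorm p s * wnorm q s"
proof (induction p)
  case (pCons a p)
  have "wnorm (pCons a p * q) s \<le> wnorm (smult a q) s + wnorm (pCons 0 (p * q)) s"
    unfolding mult_pCons_left by (rule wnorm_add_le[OF s])
  also have "\<dots> \<le> \<bar>a\<bar> * wnorm q s + s * (wnorm p s * wnorm q s)"
    using mult_left_mono[OF pCons.IH s] by (simp add: wnorm_smult wnorm_pCons)
  finally show ?case by (simp add: wnorm_pCons algebra_simps)
qed simp

lemma wnorm_power_le:
  assumes "s \<ge> 0"
  shows "wnorm (p ^ k) s \<le> wnorm p s ^ k"
proof (induction k)
  case (Suc k)
  have "wnorm (p ^ Suc k) s \<le> wnorm p s * wnorm (p ^ k) s"
    unfolding power_Suc by (rule wnorm_mult_le[OF assms])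
  also have "\<dots> \<le> wnorm p s * wnorm p s ^ k"
    using Suc wnorm_nonneg[OF assms] by (rule mult_left_mono)
  finally show ?case by simp
qed simp

lemma wnorm_sum_le:
  assumes "s \<ge> 0"
  shows "wnorm (\<Sum>k\<in>A. f k) s \<le> (\<Sum>k\<in>A. wnorm (f k) s)"
proof (induction A rule: infinite_finite_induct)
  case (insert x F)
  then show ?case using wnorm_add_le[OF assms, of "f x" "sum f F"] by simp
qed simp_all

lemma wnorm_diff_le:
  assumes "s \<ge> 0"
  shows "wnorm (p - q) s \<le> wnorm p s + wnorm q s"
  using wnorm_add_le[OF assms, of p "smult (- 1) q"] wnorm_smult[of "- 1" q s] by simp

lemma norm_peval_le:
  assumes "\<And>j. norm (x ^ j) \<le> C * e ^ j"
  shows "norm (peval p x) \<le> C * wnorm p e"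
proof -
  have "norm (peval p x) \<le> (\<Sum>j\<le>degree p. \<bar>coeff p j\<bar> * (C * e ^ j))"
    unfolding peval_def using assms by (intro sum_norm_le) (simp add: mult_left_mono)
  also have "\<dots> = C * wnorm p e"
    by (simp add: wnorm_def sum_distrib_left mult_ac)
  finally show ?thesis .
qed

text \<open>Halving the weight gains a factor \<open>2\<^bsup>-N\<^esup>\<close> on a polynomial that vanishes to order \<open>N\<close>.\<close>

lemma wnorm_half_le:
  assumes p: "\<And>j. j < N \<Longrightarrow> coeff p j = 0" and e: "e \<ge> 0"
  shows "wnorm p e \<le> (1 / 2) ^ N * wnorm p (2 * e)"
  unfolding wnorm_def sum_distrib_left
proof (intro sum_mono)
  fix j
  show "\<bar>coeff p j\<bar> * e ^ j \<le> (1 / 2) ^ N * (\<bar>coeff p j\<bar> * (2 * e) ^ j)"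
  proof (cases "j < N")
    case True
    then show ?thesis by (simp add: p)
  next
    case False
    then have "(1 / 2 :: real) ^ j \<le> (1 / 2) ^ N" by (intro power_decreasing) auto
    then have "(1 / 2) ^ j * (\<bar>coeff p j\<bar> * (2 * e) ^ j) \<le> (1 / 2) ^ N * (\<bar>coeff p j\<bar> * (2 * e) ^ j)"
      using e by (intro mult_right_mono) auto
    then show ?thesis by (simp add: power_mult_distrib power_divide)
  qed
qed

lemma isCont_wnorm: "isCont (wnorm p) s"
  unfolding wnorm_def by (intro continuous_intros)

section \<open>The inverse series at a quasinilpotent element\<close>

text \<open>The spectral radius condition \<open>\<parallel>x\<^sup>j\<parallel>\<^bsup>1/j\<^esup> \<longlonglongrightarrow> 0\<close>, in the form in which it meets \<open>norm_peval_le\<close>.\<close>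

definition quasinilpotent :: "'b::{real_normed_algebra,monoid_mult} \<Rightarrow> bool"
  where "quasinilpotent x \<longleftrightarrow> (\<forall>e>0. \<exists>C. \<forall>j. norm (x ^ j) \<le> C * e ^ j)"

definition trinomial_poly :: "nat \<Rightarrow> nat \<Rightarrow> real poly"
  where "trinomial_poly m n = [:1, -1:] ^ n - [:1, -1:] ^ m"

lemma fps_of_poly_trinomial: "fps_of_poly (trinomial_poly m n) = trinomial_fps m n"
proof -
  have "fps_of_poly [:1, -1::real:] = 1 - fps_X"
    by (simp add: fps_of_poly_pCons)
  then show ?thesis
    by (simp add: trinomial_poly_def trinomial_fps_def fps_of_poly_diff fps_of_poly_power)
qed

lemma peval_trinomial: "peval (trinomial_poly m n) x = (1 - x) ^ n - (1 - x) ^ m"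
  by (simp add: trinomial_poly_def peval_diff peval_power peval_pCons)

lemma norm_power_le_power_norm:
  fixes x :: "'b::{real_normed_algebra,monoid_mult}"
  assumes "k > 0"
  shows "norm (x ^ k) \<le> norm x ^ k"
  using assms
proof (induction k rule: nat_induct_non_zero)
  case (Suc k)
  have "norm (x ^ Suc k) \<le> norm x * norm (x ^ k)" by (simp add: norm_mult_ineq)
  also have "\<dots> \<le> norm x * norm x ^ k" using Suc by (intro mult_left_mono) auto
  finally show ?case by simp
qed simp

text \<open>Below order \<open>N\<close>, cutting off the series \<open>h\<close> at \<open>N\<close> does not affect \<open>h \<circ> g = X\<close>, because \<open>g\<^sup>k\<close>
  vanishes to order \<open>k\<close>.\<close>

lemma coeff_truncated_inverse:
  assumes "0 < n" "n < m" and jN: "j < N"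
  shows "coeff ((\<Sum>k<N. smult (inv_series m n $ k) (trinomial_poly m n ^ k)) - [:0, 1:]) j = 0"
proof -
  let ?g = "trinomial_fps m n" and ?h = "inv_series m n"
  have "coeff (trinomial_poly m n ^ k) j = (?g ^ k) $ j" for k
    by (simp flip: fps_of_poly_trinomial fps_of_poly_power)
  then have "coeff (\<Sum>k<N. smult (?h $ k) (trinomial_poly m n ^ k)) j = (\<Sum>k<N. ?h $ k * (?g ^ k) $ j)"
    by (simp add: coeff_sum)
  also have "\<dots> = (\<Sum>k=0..j. ?h $ k * (?g ^ k) $ j)"
    using jN by (intro sum.mono_neutral_right)
      (auto simp: startsby_zero_power_prefix trinomial_fps_nth_0)
  also have "\<dots> = (?h oo ?g) $ j" by (simp add: fps_compose_nth)
  also have "\<dots> = coeff [:0, 1:] j"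
    by (simp add: inv_series_compose_trinomial[OF assms(1,2)] coeff_pCons split: nat.split)
  finally show ?thesis by simp
qed

text \<open>The formal identity \<open>h \<circ> g = X\<close> evaluated at a quasinilpotent element.  The partial sum of order
  \<open>N\<close> differs from \<open>x\<close> by a polynomial in \<open>x\<close> that vanishes to order \<open>N\<close>.  Its norm with weight
  \<open>2e\<close> is bounded in \<open>N\<close> once \<open>e\<close> is so small that \<open>h\<close> converges at \<open>wnorm g (2e)\<close>, and then the
  norm with weight \<open>e\<close> decays like \<open>2\<^bsup>-N\<^esup>\<close>.  Quasinilpotence admits every \<open>e > 0\<close>.\<close>

lemma inv_series_sums:
  fixes x :: "'b::{real_normed_algebra,monoid_mult}" and w :: real
  assumes nm: "0 < n" "n < m" and x: "quasinilpotent x"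
    and w: "0 < w" "w < 1" "(1 - w) ^ m < (1 - w) ^ n"
  shows "(\<lambda>k. (inv_series m n $ k) *\<^sub>R ((1 - x) ^ n - (1 - x) ^ m) ^ k) sums x"
proof -
  let ?h = "inv_series m n" and ?g = "trinomial_poly m n"
  define p where "p N = (\<Sum>k<N. smult (?h $ k) (?g ^ k)) - [:0, 1:]" for N
  have "wnorm ?g 0 = \<bar>trinomial_fps m n $ 0\<bar>"
    unfolding fps_of_poly_trinomial[symmetric] by (simp add: wnorm_def power_0_left if_distrib cong: if_cong)
  then have "wnorm ?g 0 = 0" by (simp add: trinomial_fps_nth_0)
  moreover have "isCont (wnorm ?g) 0" by (rule isCont_wnorm)
  ultimately have "\<forall>\<^sub>F s in at 0. wnorm ?g s < (1 - w) ^ n - (1 - w) ^ m"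
    using w by (intro order_tendstoD[of _ 0]) (auto simp: isCont_def)
  then obtain d where d: "d > 0" "\<And>s. s \<noteq> 0 \<Longrightarrow> dist s 0 < d \<Longrightarrow> wnorm ?g s < (1 - w) ^ n - (1 - w) ^ m"
    unfolding eventually_at by blast
  define e where "e = d / 4"
  have e: "e > 0" "wnorm ?g (2 * e) < (1 - w) ^ n - (1 - w) ^ m"
    using d by (auto simp: e_def)
  obtain L where L: "L < w" "\<And>N. psum ?h N (wnorm ?g (2 * e)) \<le> L"
    using psum_inv_series_bounded[OF nm w(1,2) wnorm_nonneg e(2)] e(1) by auto
  obtain C where C: "\<And>j. norm (x ^ j) \<le> C * e ^ j"
    using x e(1) unfolding quasinilpotent_def by blast
  have C0: "C \<ge> 0" using order_trans[OF norm_ge_zero C[of 0]] by simp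
  have est: "norm (peval (p N) x) \<le> C * ((1 / 2) ^ N * (L + 2 * e))" for N
  proof -
    have "wnorm (\<Sum>k<N. smult (?h $ k) (?g ^ k)) (2 * e) \<le> (\<Sum>k<N. ?h $ k * wnorm (?g ^ k) (2 * e))"
      using wnorm_sum_le[of "2 * e" "\<lambda>k. smult (?h $ k) (?g ^ k)" "{..<N}"] e(1)
      by (simp add: wnorm_smult inv_series_nonneg[OF nm])
    also have "\<dots> \<le> psum ?h N (wnorm ?g (2 * e))"
      unfolding psum_def using e(1)
      by (intro sum_mono mult_left_mono wnorm_power_le inv_series_nonneg[OF nm]) auto
    also have "\<dots> \<le> L" by (rule L)
    finally have "wnorm (p N) (2 * e) \<le> L + wnorm [:0, 1:] (2 * e)"
      unfolding p_def using wnorm_diff_le[of "2 * e"] e(1) by (smt (verit, best))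
    also have "wnorm [:0, 1:] (2 * e) = 2 * e" by (simp add: wnorm_pCons)
    finally have W: "wnorm (p N) (2 * e) \<le> L + 2 * e" .
    have "norm (peval (p N) x) \<le> C * wnorm (p N) e" by (rule norm_peval_le[OF C])
    also have "wnorm (p N) e \<le> (1 / 2) ^ N * wnorm (p N) (2 * e)"
      unfolding p_def using e(1) by (intro wnorm_half_le coeff_truncated_inverse[OF nm]) auto
    also have "\<dots> \<le> (1 / 2) ^ N * (L + 2 * e)" by (intro mult_left_mono W) auto
    finally show ?thesis using C0 by (simp add: mult_left_mono)
  qed
  have "(\<lambda>N. C * ((1 / 2) ^ N * (L + 2 * e))) \<longlonglongrightarrow> C * (0 * (L + 2 * e))"
    by (intro tendsto_mult_left tendsto_mult_right LIMSEQ_power_zero) simp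
  then have "(\<lambda>N. peval (p N) x) \<longlonglongrightarrow> 0"
    by (intro Lim_null_comparison[OF always_eventually[OF allI[OF est]]]) simp
  moreover have "peval (p N) x = (\<Sum>k<N. (?h $ k) *\<^sub>R ((1 - x) ^ n - (1 - x) ^ m) ^ k) - x" for N
    by (simp add: p_def peval_diff peval_sum peval_smult peval_power peval_trinomial peval_pCons)
  ultimately show ?thesis by (simp add: sums_def LIM_zero_iff)
qed

text \<open>With nonnegative coefficients \<open>h\<^sub>k\<close>, the expansion \<open>x = \<Sum> h\<^sub>k u\<^sup>k\<close> gives
  \<open>\<parallel>x\<parallel> \<le> \<Sum> h\<^sub>k \<parallel>u\<parallel>\<^sup>k\<close>, a scalar sum that \<open>psum_inv_series_bounded\<close> keeps below \<open>w\<close>.  The vanishing of \<open>h\<^sub>0\<close>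
  keeps the norm of the unit out of the estimate.\<close>

lemma quasinilpotent_norm_less:
  fixes x :: "'b::{real_normed_algebra,monoid_mult}" and w :: real
  assumes nm: "0 < n" "n < m" and x: "quasinilpotent x"
    and w: "0 < w" "w < 1" and r: "norm ((1 - x) ^ n - (1 - x) ^ m) < (1 - w) ^ n - (1 - w) ^ m"
  shows "norm x < w"
proof -
  let ?h = "inv_series m n" and ?u = "(1 - x) ^ n - (1 - x) ^ m"
  obtain L where L: "L < w" "\<And>N. psum ?h N (norm ?u) \<le> L"
    using psum_inv_series_bounded[OF nm w _ r] by auto
  have "(1 - w) ^ m < (1 - w) ^ n" using le_less_trans[OF norm_ge_zero r] by simp
  then have "(\<lambda>k. (?h $ k) *\<^sub>R ?u ^ k) sums x" by (rule inv_series_sums[OF nm x w])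
  then have "(\<lambda>N. norm (\<Sum>k<N. (?h $ k) *\<^sub>R ?u ^ k)) \<longlonglongrightarrow> norm x"
    unfolding sums_def by (rule tendsto_norm)
  moreover have "norm (\<Sum>k<N. (?h $ k) *\<^sub>R ?u ^ k) \<le> L" for N
  proof -
    have "norm (\<Sum>k<N. (?h $ k) *\<^sub>R ?u ^ k) \<le> psum ?h N (norm ?u)"
      unfolding psum_def
    proof (intro sum_norm_le)
      fix k
      show "norm ((?h $ k) *\<^sub>R ?u ^ k) \<le> ?h $ k * norm ?u ^ k"
        using norm_power_le_power_norm[of k ?u] inv_series_nonneg[OF nm, of k]
        by (cases "k = 0") (auto simp: inv_series_nth_0 mult_left_mono)
    qed
    with L(2)[of N] show ?thesis by linarith
  qed
  ultimately have "norm x \<le> L" by (intro LIMSEQ_le_const2) auto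
  with L(1) show ?thesis by simp
qed

section \<open>Quasinilpotence from an everywhere defined resolvent\<close>

lemma sum_roots_unity_power:
  fixes n k :: nat
  assumes "0 < k" "k < n"
  shows "(\<Sum>j<n. exp (2 * of_real pi * \<i> * of_nat j / of_nat n) ^ k) = (0::complex)"
proof -
  let ?z = "exp (2 * of_real pi * \<i> * of_nat k / of_nat n) :: complex"
  have "\<not> n dvd k" using assms by (auto dest: dvd_imp_le)
  then have z1: "?z \<noteq> 1" using complex_root_unity_eq_1[of n k] assms by simp
  have "?z ^ n = exp (of_nat n * (2 * of_real pi * \<i> * of_nat k / of_nat n))"
    by (rule exp_of_nat_mult[symmetric])
  also have "\<dots> = exp (2 * of_real pi * \<i> * of_nat k)" using assms by simp
  also have "\<dots> = 1"
    using complex_root_unity_eq_1[of 1 k] by simp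
  finally have zn: "?z ^ n = 1" .
  have "(\<Sum>j<n. exp (2 * of_real pi * \<i> * of_nat j / of_nat n) ^ k) = (\<Sum>j<n. ?z ^ j)"
    by (intro sum.cong refl) (simp add: mult_ac flip: exp_of_nat_mult)
  also have "\<dots> = 0" using z1 zn by (simp add: geometric_sum)
  finally show ?thesis .
qed

text \<open>A homomorphism from \<open>\<complex>\<close> replaces the structure of a complex algebra.  So the results apply to the
  algebra of real-linear operators on a complex space, where scalars commute only with the
  complex-linear operators, such as \<open>x\<close>.\<close>

locale complex_scalars =
  fixes J :: "complex \<Rightarrow> 'b::{real_normed_algebra,monoid_mult}" and x :: 'b
  assumes J_of_real: "J (of_real r) = r *\<^sub>R 1"
    and J_add: "J (a + b) = J a + J b"
    and J_mult: "J (a * b) = J a * J b"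
    and norm_J_mult: "norm (J a * y) \<le> cmod a * norm y"
    and J_commute: "J a * x = x * J a"
begin

lemma J_0: "J 0 = 0" and J_1: "J 1 = 1"
  using J_of_real[of 0] J_of_real[of 1] by simp_all

lemma J_minus: "J (- a) = - J a"
  using J_add[of a "- a"] by (simp add: J_0 eq_neg_iff_add_eq_0 add.commute)

lemma J_diff: "J (a - b) = J a - J b"
  using J_add[of a "- b"] by (simp add: J_minus)

lemma J_sum: "J (\<Sum>i\<in>A. f i) = (\<Sum>i\<in>A. J (f i))"
  by (induction A rule: infinite_finite_induct) (simp_all add: J_0 J_add)

lemma J_mult_power: "(J a * x) ^ k = J (a ^ k) * x ^ k"
proof (induction k)
  case 0
  then show ?case by (simp add: J_1)
next
  case (Suc k)
  have c: "J b * x ^ k = x ^ k * J b" for b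
  proof (induction k)
    case (Suc k)
    have "J b * x ^ Suc k = x * (J b * x ^ k)"
      by (simp add: J_commute flip: mult.assoc)
    then show ?case by (simp add: Suc mult.assoc)
  qed simp
  have "(J a * x) ^ Suc k = J (a ^ k) * (x ^ k * J a) * x"
    by (simp add: power_Suc2 Suc mult.assoc del: power_Suc)
  also have "\<dots> = J (a ^ k) * J a * x ^ k * x" by (simp add: c[symmetric] mult.assoc)
  also have "\<dots> = J (a ^ Suc k) * x ^ Suc k"
    by (simp add: power_Suc2 J_mult mult.assoc del: power_Suc)
  finally show ?case .
qed

lemma geometric_right_inverse:
  fixes a W :: 'b
  assumes "(1 - a) * W = 1"
  shows "(1 - a ^ k) * W = (\<Sum>i<k. a ^ i)"
proof (induction k)
  case (Suc k)
  have "1 - a ^ Suc k = (1 - a ^ k) + a ^ k * (1 - a)"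
    by (simp add: algebra_simps power_Suc2 del: power_Suc)
  then have "(1 - a ^ Suc k) * W = (1 - a ^ k) * W + a ^ k * ((1 - a) * W)"
    by (simp only: distrib_right mult.assoc)
  then show ?case using Suc assms by simp
qed simp

text \<open>This encodes that the spectrum of \<open>x\<close> is contained in \<open>{0}\<close>: for \<open>z \<noteq> 0\<close>, the inverse \<open>W z\<close> is
  \<open>1/z\<close> times the resolvent of \<open>x\<close> at \<open>1/z\<close>.\<close>

context
  fixes W :: "complex \<Rightarrow> 'b"
  assumes W_left: "W z * (1 - J z * x) = 1"
    and W_right: "(1 - J z * x) * W z = 1"
begin

lemma resolvent_diff: "W z - W w = W z * (J (z - w) * (x * W w))"
proof -
  have "W z - W w = W z * ((1 - J w * x) * W w) - (W z * (1 - J z * x)) * W w"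
    by (simp add: W_left W_right)
  also have "\<dots> = W z * (J (z - w) * (x * W w))"
    by (simp add: algebra_simps J_diff)
  finally show ?thesis .
qed

lemma norm_resolvent_diff: "norm (W z - W w) \<le> norm (W z) * (cmod (z - w) * (norm x * norm (W w)))"
proof -
  have "norm (W z - W w) \<le> norm (W z) * norm (J (z - w) * (x * W w))"
    unfolding resolvent_diff by (rule norm_mult_ineq)
  also have "\<dots> \<le> norm (W z) * (cmod (z - w) * norm (x * W w))"
    by (intro mult_left_mono norm_J_mult) auto
  also have "\<dots> \<le> norm (W z) * (cmod (z - w) * (norm x * norm (W w)))"
    by (intro mult_left_mono norm_mult_ineq) auto
  finally show ?thesis .
qed

lemma resolvent_locally_bounded:
  "\<exists>e>0. \<forall>z. dist z w < e \<longrightarrow> norm (W z) \<le> 2 * norm (W w)"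
proof -
  define e where "e = 1 / (2 * (norm x * norm (W w)) + 1)"
  have den: "2 * (norm x * norm (W w)) + 1 > 0" by (simp add: add_nonneg_pos)
  have "norm (W z) \<le> 2 * norm (W w)" if z: "dist z w < e" for z
  proof -
    have "cmod (z - w) * (norm x * norm (W w)) \<le> e * (norm x * norm (W w))"
      using z by (intro mult_right_mono) (auto simp: dist_norm)
    also have "\<dots> \<le> 1 / 2" using den by (simp add: e_def field_simps)
    finally have "norm (W z) * (cmod (z - w) * (norm x * norm (W w))) \<le> norm (W z) * (1 / 2)"
      by (rule mult_left_mono) simp
    then have "norm (W z - W w) \<le> norm (W z) / 2"
      using norm_resolvent_diff[of z w] by simp
    then show ?thesis using norm_triangle_ineq2[of "W z" "W w"] by simp
  qed
  then show ?thesis using den by (intro exI[of _ e]) (auto simp: e_def)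
qed

text \<open>Local boundedness and compactness.  By \<open>norm_resolvent_diff\<close> such a bound also makes \<open>W\<close> Lipschitz
  on the ball.\<close>

lemma resolvent_bounded_on_cball: "\<exists>M>0. \<forall>z\<in>cball 0 T. norm (W z) \<le> M"
proof -
  obtain e where e: "\<And>w. e w > 0" "\<And>w z. dist z w < e w \<Longrightarrow> norm (W z) \<le> 2 * norm (W w)"
    using resolvent_locally_bounded by metis
  have "\<exists>F. finite F \<and> cball 0 T \<subseteq> (\<Union>w\<in>F. ball w (e w))"
  proof -
    have "cball (0::complex) T \<subseteq> (\<Union>w\<in>UNIV. ball w (e w))"
    proof
      fix z :: complex
      have "z \<in> ball z (e z)" using e(1) by simp
      then show "z \<in> (\<Union>w\<in>UNIV. ball w (e w))" by blast
    qed
    then obtain F where "F \<subseteq> UNIV" "finite F" "cball 0 T \<subseteq> (\<Union>w\<in>F. ball w (e w))"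
      by (rule compactE_image[OF compact_cball, rotated]) auto
    then show ?thesis by blast
  qed
  then obtain F where F: "finite F" "cball 0 T \<subseteq> (\<Union>w\<in>F. ball w (e w))" by blast
  define M where "M = (\<Sum>w\<in>F. 2 * norm (W w)) + 1"
  have "M > 0" unfolding M_def by (intro add_nonneg_pos sum_nonneg) auto
  moreover have "norm (W z) \<le> M" if "z \<in> cball 0 T" for z
  proof -
    from that F obtain w where w: "w \<in> F" "dist z w < e w" by (auto simp: dist_commute)
    have "norm (W z) \<le> 2 * norm (W w)" by (rule e(2)[OF w(2)])
    also have "\<dots> \<le> (\<Sum>w\<in>F. 2 * norm (W w))"
      using F(1) w(1) by (intro member_le_sum) auto
    finally show ?thesis by (simp add: M_def)
  qed
  ultimately show ?thesis by blast
qed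

text \<open>The mean of \<open>W\<close> over the \<open>n\<close> points \<open>\<omega> t\<close> with \<open>\<omega>\<^sup>n = 1\<close>.  It replaces contour integrals of the
  resolvent: it inherits bounds and Lipschitz constants of \<open>W\<close> independently of \<open>n\<close>, and
  it inverts \<open>1 - t\<^sup>n x\<^sup>n\<close>.\<close>

definition root_avg :: "nat \<Rightarrow> real \<Rightarrow> 'b"
  where "root_avg n t = (1 / real n) *\<^sub>R
    (\<Sum>j<n. W (exp (2 * of_real pi * \<i> * of_nat j / of_nat n) * of_real t))"

text \<open>As \<open>(\<omega> t x)\<^sup>n = t\<^sup>n x\<^sup>n\<close>, the product \<open>(1 - t\<^sup>n x\<^sup>n) W(\<omega> t)\<close> is the finite geometric sum of the powers of
  \<open>\<omega> t x\<close>.  Summing over the roots of unity \<open>\<omega>\<close> leaves only the constant term, \<open>n\<close> times.\<close>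

lemma root_avg_inverse:
  assumes n: "n > 0"
  shows "(1 - t ^ n *\<^sub>R x ^ n) * root_avg n t = 1"
proof -
  let ?w = "\<lambda>j. exp (2 * of_real pi * \<i> * of_nat j / of_nat n) :: complex"
  have wn: "?w j ^ n = 1" for j
  proof -
    have "?w j ^ n = exp (of_nat n * (2 * of_real pi * \<i> * of_nat j / of_nat n))"
      by (rule exp_of_nat_mult[symmetric])
    also have "\<dots> = exp (2 * of_real pi * \<i> * of_nat j)" using n by simp
    also have "\<dots> = 1" using complex_root_unity_eq_1[of 1 j] by simp
    finally show ?thesis .
  qed
  have pw: "(J (?w j * of_real t) * x) ^ n = t ^ n *\<^sub>R x ^ n" for j
    using J_of_real[of "t ^ n"] by (simp add: J_mult_power power_mult_distrib wn)
  have "(1 - t ^ n *\<^sub>R x ^ n) * (\<Sum>j<n. W (?w j * of_real t))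
      = (\<Sum>j<n. (1 - (J (?w j * of_real t) * x) ^ n) * W (?w j * of_real t))"
    by (simp add: sum_distrib_left pw)
  also have "\<dots> = (\<Sum>j<n. \<Sum>k<n. (J (?w j * of_real t) * x) ^ k)"
    by (intro sum.cong refl geometric_right_inverse W_right)
  also have "\<dots> = (\<Sum>k<n. \<Sum>j<n. J (?w j ^ k * of_real t ^ k) * x ^ k)"
    by (subst sum.swap) (simp add: J_mult_power power_mult_distrib)
  also have "\<dots> = (\<Sum>k<n. J ((\<Sum>j<n. ?w j ^ k) * of_real t ^ k) * x ^ k)"
    by (simp add: J_sum sum_distrib_right)
  also have "\<dots> = (\<Sum>k<n. if k = 0 then real n *\<^sub>R 1 else 0)"
  proof (intro sum.cong refl)
    fix k assume k: "k \<in> {..<n}"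
    show "J ((\<Sum>j<n. ?w j ^ k) * of_real t ^ k) * x ^ k = (if k = 0 then real n *\<^sub>R 1 else 0)"
    proof (cases "k = 0")
      case True
      then show ?thesis using J_of_real[of "real n"] by simp
    next
      case False
      then have "(\<Sum>j<n. ?w j ^ k) = 0" using k by (intro sum_roots_unity_power) auto
      then show ?thesis using False by (simp add: J_0)
    qed
  qed
  also have "\<dots> = real n *\<^sub>R 1" using n by simp
  finally show ?thesis using n by (simp add: root_avg_def)
qed

lemma norm_root_avg_le:
  assumes "n > 0" "\<And>z. z \<in> cball 0 T \<Longrightarrow> norm (W z) \<le> M" "\<bar>t\<bar> \<le> T"
  shows "norm (root_avg n t) \<le> M"
proof -
  have "norm (\<Sum>j<n. W (exp (2 * of_real pi * \<i> * of_nat j / of_nat n) * of_real t)) \<le> (\<Sum>j<n. M)"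
    using assms by (intro sum_norm_le assms(2)) (simp add: norm_mult norm_exp)
  then have "(1 / real n) * norm (\<Sum>j<n. W (exp (2 * of_real pi * \<i> * of_nat j / of_nat n) * of_real t))
      \<le> (1 / real n) * (real n * M)"
    by (intro mult_left_mono) auto
  then show ?thesis using assms(1) by (simp add: root_avg_def)
qed

lemma norm_root_avg_diff_le:
  assumes "n > 0" and M: "\<And>z. z \<in> cball 0 T \<Longrightarrow> norm (W z) \<le> M" and "\<bar>t\<bar> \<le> T" "\<bar>s\<bar> \<le> T" "M \<ge> 0"
  shows "norm (root_avg n s - root_avg n t) \<le> M\<^sup>2 * norm x * \<bar>s - t\<bar>"
proof -
  let ?w = "\<lambda>j. exp (2 * of_real pi * \<i> * of_nat j / of_nat n) :: complex"
  have "norm (\<Sum>j<n. W (?w j * of_real s) - W (?w j * of_real t)) \<le> (\<Sum>j<n. M\<^sup>2 * norm x * \<bar>s - t\<bar>)"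
  proof (intro sum_norm_le)
    fix j
    have d: "cmod (?w j * of_real s - ?w j * of_real t) = \<bar>s - t\<bar>"
      by (simp add: norm_mult norm_exp flip: right_diff_distrib of_real_diff)
    have "norm (W (?w j * of_real s)) \<le> M" "norm (W (?w j * of_real t)) \<le> M"
      using assms by (auto intro!: M simp: norm_mult norm_exp)
    then have "norm (W (?w j * of_real s)) * (\<bar>s - t\<bar> * (norm x * norm (W (?w j * of_real t))))
       \<le> M * (\<bar>s - t\<bar> * (norm x * M))"
      using assms by (intro mult_mono) auto
    then show "norm (W (?w j * of_real s) - W (?w j * of_real t)) \<le> M\<^sup>2 * norm x * \<bar>s - t\<bar>"
      using norm_resolvent_diff[of "?w j * of_real s" "?w j * of_real t"]
      unfolding d by (simp add: power2_eq_square mult_ac)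
  qed
  then have "(1 / real n) * norm (\<Sum>j<n. W (?w j * of_real s) - W (?w j * of_real t))
      \<le> (1 / real n) * (real n * (M\<^sup>2 * norm x * \<bar>s - t\<bar>))"
    by (intro mult_left_mono) auto
  moreover have "root_avg n s - root_avg n t
      = (1 / real n) *\<^sub>R (\<Sum>j<n. W (?w j * of_real s) - W (?w j * of_real t))"
    by (simp only: root_avg_def sum_subtractf scaleR_diff_right)
  ultimately show ?thesis using assms(1) by simp
qed

text \<open>If \<open>t\<^sup>n x\<^sup>n \<longlonglongrightarrow> 0\<close>, the averages at \<open>t\<close> tend to \<open>1\<close>.  By the Lipschitz bound, those at \<open>t + 2d\<close>
  are eventually within \<open>1/2\<close> of \<open>1\<close>, so their inverses \<open>1 - (t + 2d)\<^sup>n x\<^sup>n\<close> are bounded.  Retreating from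
  \<open>t + 2d\<close> to \<open>t + d\<close> turns boundedness of the powers into geometric decay.\<close>

lemma powers_null_step:
  assumes M: "\<And>z. z \<in> cball 0 T \<Longrightarrow> norm (W z) \<le> M" "M > 0"
    and d: "d > 0" "M\<^sup>2 * norm x * (2 * d) \<le> 1 / 4"
    and t: "0 \<le> t" "t + 2 * d \<le> T" and null: "(\<lambda>n. t ^ n * norm (x ^ n)) \<longlonglongrightarrow> 0"
  shows "(\<lambda>n. (t + d) ^ n * norm (x ^ n)) \<longlonglongrightarrow> 0"
proof -
  let ?s = "t + 2 * d"
  have "\<forall>\<^sub>F n in sequentially. t ^ n * norm (x ^ n) < 1 / (4 * M)"
    using M(2) by (intro order_tendstoD(2)[OF null]) simp
  moreover have "\<forall>\<^sub>F n in sequentially. n > (0::nat)" by (rule eventually_gt_at_top)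
  ultimately have bd: "\<forall>\<^sub>F n in sequentially. ?s ^ n * norm (x ^ n) \<le> 3 * norm (1::'b)"
  proof eventually_elim
    case (elim n)
    let ?A = "root_avg n" and ?y = "1 - ?s ^ n *\<^sub>R x ^ n"
    have "?A t - 1 = (t ^ n *\<^sub>R x ^ n) * ?A t"
      using root_avg_inverse[OF elim(2), of t] by (simp add: algebra_simps)
    then have "norm (?A t - 1) \<le> norm (t ^ n *\<^sub>R x ^ n) * norm (?A t)"
      by (simp only: norm_mult_ineq)
    also have "\<dots> \<le> 1 / (4 * M) * M"
      using elim(1) t d M(2) norm_root_avg_le[OF elim(2) M(1), of t]
      by (intro mult_mono) auto
    finally have 1: "norm (?A t - 1) \<le> 1 / 4" using M(2) by simp
    have "norm (?A ?s - ?A t) \<le> M\<^sup>2 * norm x * \<bar>?s - t\<bar>"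
      using t d M(2) by (intro norm_root_avg_diff_le[OF elim(2) M(1)]) auto
    with d have 2: "norm (?A ?s - ?A t) \<le> 1 / 4" by simp
    have 3: "norm (?A ?s - 1) \<le> 1 / 2"
      using norm_triangle_ineq[of "?A ?s - ?A t" "?A t - 1"] 1 2 by simp
    have "?y = 1 - ?y * (?A ?s - 1)"
      using root_avg_inverse[OF elim(2), of ?s] by (simp add: algebra_simps)
    then have "norm ?y \<le> norm (1::'b) + norm (?y * (?A ?s - 1))"
      by (metis norm_triangle_ineq4)
    also have "norm (?y * (?A ?s - 1)) \<le> norm ?y * (1 / 2)"
      using 3 by (intro order_trans[OF norm_mult_ineq] mult_left_mono) auto
    finally have "norm ?y \<le> 2 * norm (1::'b)" by simp
    then have "norm (?s ^ n *\<^sub>R x ^ n) \<le> 3 * norm (1::'b)"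
      using norm_triangle_ineq4[of 1 ?y] by simp
    then show ?case using t d by simp
  qed
  define q where "q = (t + d) / ?s"
  have q: "0 \<le> q" "q < 1" using t d by (auto simp: q_def)
  have "\<forall>\<^sub>F n in sequentially. norm ((t + d) ^ n * norm (x ^ n)) \<le> 3 * norm (1::'b) * q ^ n"
    using bd
  proof eventually_elim
    case (elim n)
    have "q * ?s = t + d" using t d by (simp add: q_def)
    then have "(t + d) ^ n = q ^ n * ?s ^ n" by (simp only: flip: power_mult_distrib)
    then have "(t + d) ^ n * norm (x ^ n) = q ^ n * (?s ^ n * norm (x ^ n))" by simp
    also have "\<dots> \<le> q ^ n * (3 * norm (1::'b))" using elim q by (intro mult_left_mono) auto
    finally show ?case using t d by (simp add: mult.commute)
  qed
  moreover have "(\<lambda>n. 3 * norm (1::'b) * q ^ n) \<longlonglongrightarrow> 0"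
    using q by (intro tendsto_mult_right_zero LIMSEQ_power_zero) simp
  ultimately show ?thesis by (rule Lim_null_comparison)
qed

text \<open>The step length allowed by \<open>powers_null_step\<close> depends only on a bound for \<open>W\<close> on a fixed ball, so
  finitely many equal steps lead from \<open>0\<close> to \<open>T\<close>.  The ball has radius \<open>2T\<close> because each step looks
  ahead by twice its length.\<close>

lemma powers_null:
  assumes T: "T > 0"
  shows "(\<lambda>n. T ^ n * norm (x ^ n)) \<longlonglongrightarrow> 0"
proof -
  obtain M where M: "M > 0" "\<And>z. z \<in> cball 0 (2 * T) \<Longrightarrow> norm (W z) \<le> M"
    using resolvent_bounded_on_cball by blast
  define K where "K = M\<^sup>2 * norm x"
  have K: "K \<ge> 0" by (simp add: K_def)
  obtain N :: nat where N: "real N > 8 * K * T + 2" using reals_Archimedean2 by blast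
  define d where "d = T / real N"
  have N2: "real N > 2" using N mult_nonneg_nonneg[of "8 * K" T] K T by linarith
  have d: "d > 0" using T N2 by (simp add: d_def)
  have Nd: "real N * d = T" using N2 by (simp add: d_def)
  have dT: "2 * d \<le> T" using N2 T by (simp add: d_def field_simps)
  have Kd: "K * (2 * d) \<le> 1 / 4" using N N2 by (simp add: d_def field_simps)
  have "(\<lambda>n. (real k * d) ^ n * norm (x ^ n)) \<longlonglongrightarrow> 0" if "k \<le> N" for k
    using that
  proof (induction k)
    case 0
    have "\<forall>\<^sub>F n in sequentially. (real 0 * d) ^ n * norm (x ^ n) = 0"
      using eventually_gt_at_top[of 0] by eventually_elim simp
    then show ?case by (rule tendsto_eventually)
  next
    case (Suc k)
    have "real k * d \<le> real N * d" using Suc.prems d by (intro mult_right_mono) auto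
    then have "real k * d + 2 * d \<le> 2 * T" using Nd dT by simp
    then have "(\<lambda>n. (real k * d + d) ^ n * norm (x ^ n)) \<longlonglongrightarrow> 0"
      using Suc d Kd by (intro powers_null_step[OF M(2,1)]) (auto simp: K_def)
    then show ?case by (simp add: algebra_simps)
  qed
  from this[of N] show ?thesis by (simp add: Nd)
qed

lemma quasinilpotent_of_resolvent: "quasinilpotent x"
  unfolding quasinilpotent_def
proof (intro allI impI)
  fix e :: real assume e: "e > 0"
  have "(\<lambda>n. (1 / e) ^ n * norm (x ^ n)) \<longlonglongrightarrow> 0" using e by (intro powers_null) simp
  then have "Bseq (\<lambda>n. (1 / e) ^ n * norm (x ^ n))" by (intro convergent_imp_Bseq convergentI)
  then obtain C where C: "\<And>n. norm ((1 / e) ^ n * norm (x ^ n)) \<le> C" unfolding Bseq_def by blast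
  have "norm (x ^ n) \<le> C * e ^ n" for n
    using C[of n] e by (simp add: power_divide field_simps)
  then show "\<exists>C. \<forall>n. norm (x ^ n) \<le> C * e ^ n" by blast
qed

end

end

section \<open>The algebra of bounded operators\<close>

text \<open>The algebra of bounded endomorphisms as a type with one parameter, so that composition can serve
  as the product of an instance of the algebra classes.  Its elements are only real-linear;
  complex scalars enter as the elements \<open>scalar_endo c\<close> of the algebra.\<close>

typedef (overloaded) 'a endo = "{f :: 'a::real_normed_vector \<Rightarrow> 'a. bounded_linear f}"
  morphisms endo_apply Endo
  using bounded_linear_zero by blast

setup_lifting type_definition_endo

instantiation endo :: (real_normed_vector) real_normed_algebra
begin

lift_definition norm_endo :: "'a endo \<Rightarrow> real" is onorm .

lift_definition zero_endo :: "'a endo" is "\<lambda>x. 0"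
  by (rule bounded_linear_zero)

lift_definition uminus_endo :: "'a endo \<Rightarrow> 'a endo" is "\<lambda>f x. - f x"
  by (rule bounded_linear_minus)

lift_definition plus_endo :: "'a endo \<Rightarrow> 'a endo \<Rightarrow> 'a endo" is "\<lambda>f g x. f x + g x"
  by (rule bounded_linear_add)

lift_definition minus_endo :: "'a endo \<Rightarrow> 'a endo \<Rightarrow> 'a endo" is "\<lambda>f g x. f x - g x"
  by (rule bounded_linear_sub)

lift_definition scaleR_endo :: "real \<Rightarrow> 'a endo \<Rightarrow> 'a endo" is "\<lambda>r f x. r *\<^sub>R f x"
  by (rule bounded_linear_const_scaleR)

lift_definition times_endo :: "'a endo \<Rightarrow> 'a endo \<Rightarrow> 'a endo" is "\<lambda>f g x. f (g x)"
  by (rule bounded_linear_compose)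

definition dist_endo :: "'a endo \<Rightarrow> 'a endo \<Rightarrow> real"
  where "dist_endo f g = norm (f - g)"

definition sgn_endo :: "'a endo \<Rightarrow> 'a endo"
  where "sgn_endo f = inverse (norm f) *\<^sub>R f"

definition uniformity_endo :: "('a endo \<times> 'a endo) filter"
  where "uniformity_endo = (INF e\<in>{0 <..}. principal {(f, g). dist f g < e})"

definition open_endo :: "'a endo set \<Rightarrow> bool"
  where "open_endo S = (\<forall>f\<in>S. \<forall>\<^sub>F (f', g) in uniformity. f' = f \<longrightarrow> g \<in> S)"

instance
proof
  fix f g h :: "'a endo" and r s :: real
  show "norm (f * g) \<le> norm f * norm g"
    by transfer (use onorm_compose in \<open>auto simp: o_def\<close>)
  show "norm (f + g) \<le> norm f + norm g"
    by transfer (rule onorm_triangle)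
  show "norm f = 0 \<longleftrightarrow> f = 0"
    by transfer (auto simp: onorm_eq_0)
  show "norm (r *\<^sub>R f) = \<bar>r\<bar> * norm f"
    by transfer (rule onorm_scaleR)
  show "f * (g + h) = f * g + f * h" "f * (r *\<^sub>R g) = r *\<^sub>R (f * g)"
    by (transfer, simp add: linear_simps)+
qed (simp_all add: dist_endo_def sgn_endo_def uniformity_endo_def open_endo_def,
  (transfer, simp add: algebra_simps fun_eq_iff)+)

end

instantiation endo :: (real_normed_vector) monoid_mult
begin

lift_definition one_endo :: "'a endo" is "\<lambda>x. x"
  by (rule bounded_linear_ident)

instance
  by standard (transfer, simp)+

end

lemma endo_apply_power: "endo_apply (f ^ k) = endo_apply f ^^ k"
  by (induction k) (simp_all add: one_endo.rep_eq times_endo.rep_eq fun_eq_iff id_def)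

lemma bounded_linear_scaleC: "bounded_linear (\<lambda>x::'a::complex_banach. c *\<^sub>C x)"
proof (rule bounded_linear_intro[where K = "cmod c"])
  fix r and x :: 'a
  show "c *\<^sub>C (r *\<^sub>R x) = r *\<^sub>R (c *\<^sub>C x)"
    by (simp add: scaleC_scaleC mult.commute flip: scaleC_of_real)
qed (simp_all add: scaleC_add_right norm_scaleC mult.commute)

lift_definition scalar_endo :: "complex \<Rightarrow> 'a::complex_banach endo" is "\<lambda>c x. c *\<^sub>C x"
  by (rule bounded_linear_scaleC)

lemma complex_scalars_endo:
  fixes f :: "'a::complex_banach endo"
  assumes f: "\<And>c v. endo_apply f (c *\<^sub>C v) = c *\<^sub>C endo_apply f v"
  shows "complex_scalars scalar_endo f"
proof
  fix a b :: complex and r :: real and g :: "'a endo"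
  show "scalar_endo (of_real r) = r *\<^sub>R (1 :: 'a endo)"
    by transfer (simp add: fun_eq_iff scaleC_of_real)
  show "scalar_endo (a + b) = scalar_endo a + (scalar_endo b :: 'a endo)"
    by transfer (simp add: fun_eq_iff scaleC_add_left)
  show "scalar_endo (a * b) = scalar_endo a * (scalar_endo b :: 'a endo)"
    by transfer (simp add: fun_eq_iff scaleC_scaleC)
  show "norm (scalar_endo a * g) \<le> cmod a * norm g"
  proof transfer
    fix a and g :: "'a \<Rightarrow> 'a" assume g: "bounded_linear g"
    show "onorm (\<lambda>x. a *\<^sub>C g x) \<le> cmod a * onorm g"
      by (intro onorm_bound)
        (auto simp: norm_scaleC mult.assoc onorm_pos_le[OF g] intro!: mult_left_mono onorm[OF g])
  qed
  show "scalar_endo a * f = f * scalar_endo a"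
    using f by transfer simp
qed

text \<open>For \<open>z \<noteq> 0\<close> one has \<open>1 - z (1 - f) = z (f - c)\<close> with \<open>c = 1 - 1/z \<noteq> 1\<close>, so a spectrum inside \<open>{1}\<close>
  makes \<open>1 - z (1 - f)\<close> invertible for every \<open>z\<close>.\<close>

lemma quasinilpotent_one_minus:
  fixes f :: "'a::complex_banach endo"
  assumes f: "bounded_clinear (endo_apply f)" and sp: "spectrum (endo_apply f) \<subseteq> {1}"
  shows "quasinilpotent (1 - f)"
proof -
  have fC: "endo_apply f (c *\<^sub>C v) = c *\<^sub>C endo_apply f v" for c v
    using f by (simp add: bounded_clinear_def)
  interpret complex_scalars scalar_endo "1 - f"
  proof (rule complex_scalars_endo)
    fix c and v :: 'a
    have "c *\<^sub>C (v - endo_apply f v) + c *\<^sub>C endo_apply f v = c *\<^sub>C v"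
      by (simp flip: scaleC_add_right)
    then show "endo_apply (1 - f) (c *\<^sub>C v) = c *\<^sub>C endo_apply (1 - f) v"
      by (simp add: minus_endo.rep_eq one_endo.rep_eq fC algebra_simps)
  qed
  have "\<exists>W. W * (1 - scalar_endo z * (1 - f)) = 1 \<and> (1 - scalar_endo z * (1 - f)) * W = 1" for z
  proof (cases "z = 0")
    case True
    then show ?thesis by (intro exI[of _ 1]) (simp add: J_0)
  next
    case False
    define c where "c = 1 - 1 / z"
    have "c \<notin> spectrum (endo_apply f)" using sp False by (auto simp: c_def)
    then obtain S where S: "bounded_clinear S"
        "S \<circ> (\<lambda>x. endo_apply f x - c *\<^sub>C x) = id" "(\<lambda>x. endo_apply f x - c *\<^sub>C x) \<circ> S = id"
      unfolding spectrum_def by blast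
    have bS: "bounded_linear S" using S(1) by (simp add: bounded_clinear_def)
    define R where "R = Endo S"
    have R: "endo_apply R = S" unfolding R_def using bS by (simp add: Endo_inverse)
    have RS: "R * (f - scalar_endo c) = 1" "(f - scalar_endo c) * R = 1"
      using S(2,3) by (simp_all add: endo_apply_inject[symmetric] times_endo.rep_eq
        minus_endo.rep_eq scalar_endo.rep_eq one_endo.rep_eq R o_def id_def)
    have zz: "scalar_endo z * scalar_endo (1 / z) = (1 :: 'a endo)"
      "scalar_endo (1 / z) * scalar_endo z = (1 :: 'a endo)"
      using False J_1 by (simp_all flip: J_mult)
    have "z * c = z - 1" using False by (simp add: c_def right_diff_distrib)
    then have "scalar_endo z * scalar_endo c = scalar_endo z - (1 :: 'a endo)"
      by (simp add: J_diff J_1 flip: J_mult)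
    then have e: "1 - scalar_endo z * (1 - f) = scalar_endo z * (f - scalar_endo c)"
      by (simp add: algebra_simps)
    have "(R * scalar_endo (1 / z)) * (scalar_endo z * (f - scalar_endo c))
        = R * (scalar_endo (1 / z) * scalar_endo z) * (f - scalar_endo c)"
      by (simp only: mult.assoc)
    also have "\<dots> = 1" by (simp add: zz RS)
    finally have l: "(R * scalar_endo (1 / z)) * (scalar_endo z * (f - scalar_endo c)) = 1" .
    have "(scalar_endo z * (f - scalar_endo c)) * (R * scalar_endo (1 / z))
        = scalar_endo z * ((f - scalar_endo c) * R) * scalar_endo (1 / z)"
      by (simp only: mult.assoc)
    also have "\<dots> = 1" by (simp add: zz RS)
    finally show ?thesis unfolding e using l by blast
  qed
  then obtain W where "\<And>z. W z * (1 - scalar_endo z * (1 - f)) = 1"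
      "\<And>z. (1 - scalar_endo z * (1 - f)) * W z = 1"
    by metis
  then show ?thesis by (rule quasinilpotent_of_resolvent)
qed

section \<open>The norm estimate\<close>

theorem theorem4p7:
  fixes T :: "'a::complex_banach \<Rightarrow> 'a" and m n :: nat
  assumes "bounded_clinear T"
    and "spectrum T = {1}"
    and "0 < n" and "n < m"
    and "onorm (\<lambda>x. (T ^^ m) x - (T ^^ n) x)
           < (1 - real n / real m) * (real n / real m) powr (real n / (real m - real n))"
  shows "onorm (\<lambda>x. T x - x) < 1 - (real n / real m) powr (1 / (real m - real n))"
proof -
  define f where "f = Endo T"
  have f: "endo_apply f = T" unfolding f_def
    using assms(1) by (simp add: Endo_inverse bounded_clinear_def)
  define w where "w = 1 - (real n / real m) powr (1 / (real m - real n))"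
  note crit = trinomial_critical_value[OF assms(3,4), folded w_def]
  have "norm ((1 - (1 - f)) ^ n - (1 - (1 - f)) ^ m) = norm (f ^ m - f ^ n)"
    by (simp add: norm_minus_commute)
  also have "\<dots> = onorm (\<lambda>x. (T ^^ m) x - (T ^^ n) x)"
    by (simp add: norm_endo.rep_eq minus_endo.rep_eq endo_apply_power f)
  also have "\<dots> < (1 - w) ^ n - (1 - w) ^ m" using assms(5) crit(3) by simp
  finally have "norm (1 - f) < w"
    using assms by (intro quasinilpotent_norm_less[OF assms(3,4) quasinilpotent_one_minus crit(1,2)])
      (auto simp: f)
  moreover have "norm (1 - f) = onorm (\<lambda>x. T x - x)"
    unfolding norm_minus_commute[of 1 f]
    by (simp add: norm_endo.rep_eq minus_endo.rep_eq one_endo.rep_eq f)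
  ultimately show ?thesis by (simp add: w_def)
qed

end
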